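(* Let $S:[0,1]\to[0,1]$ be a contractive interval map with a parabolic fixed point $p\in[0,1]$. If $F\subseteq[0,1]$ contains a point whose forward orbit under $S$ avoids $p$, and $S(F)\subseteq F$, then $\dim_{\mathrm{A}}F=1$.
   Context: $S$ is contractive if $|S(x)-S(y)|<|x-y|$ for all $x,y\in[0,1]$ with $x\neq y$. A parabolic fixed point of $S$ is a point $p\in[0,1]$ such that $S(p)=p$, $S$ is differentiable at $p$ and $|S'(p)|=1$ (one-sided derivatives are used if $p=0$ or $p=1$). No other regularity of $S$ is assumed. The forward orbit of $x$ is $\{x,S(x),S^2(x),\dots\}$. For a non-empty set $F\subseteq\mathbb{R}^d$, the Assouad dimension $\dim_{\mathrm{A}}F$ is the infimum of all $\alpha\ge0$ for which there is $C>0$ such that for all $0<r<R$ and $x\in F$, $N_r(B(x,R)\cap F)\le C(R/r)^{\alpha}$, where $N_r(E)$ is the minimal number of open sets of diameter at most $r$ needed to cover $E$. *)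

theory Defs
  imports "HOL-Analysis.Analysis"
begin

text \<open>The library's \<^const>\<open>diameter\<close> is real-valued and meaningless on unbounded sets, hence
  boundedness is required explicitly. The value is \<open>\<infinity>\<close> if there is no finite cover.\<close>

definition covering_number :: "real \<Rightarrow> 'a::metric_space set \<Rightarrow> enat" where
  "covering_number r E =
     (INF \<U> \<in> {\<U>. finite \<U> \<and> (\<forall>U\<in>\<U>. open U \<and> bounded U \<and> diameter U \<le> r) \<and> E \<subseteq> \<Union>\<U>}.
        enat (card \<U>))"

definition assouad_dim :: "'a::euclidean_space set \<Rightarrow> ereal" where
  "assouad_dim F =
     (INF \<alpha> \<in> {\<alpha>::real. \<alpha> \<ge> 0 \<and>
        (\<exists>C>0. \<forall>r R. \<forall>x\<in>F. 0 < r \<and> r < R \<longrightarrow>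
           ereal_of_enat (covering_number r (cball x R \<inter> F)) \<le> ereal (C * (R / r) powr \<alpha>))}.
        ereal \<alpha>)"

definition contractive_interval_map :: "(real \<Rightarrow> real) \<Rightarrow> bool" where
  "contractive_interval_map S \<longleftrightarrow>
     S ` {0..1} \<subseteq> {0..1} \<and>
     (\<forall>x\<in>{0..1}. \<forall>y\<in>{0..1}. x \<noteq> y \<longrightarrow> \<bar>S x - S y\<bar> < \<bar>x - y\<bar>)"

text \<open>The derivative within \<open>[0,1]\<close> is the ordinary one at interior points and the one-sided one
  at the endpoints.\<close>

definition parabolic_fixed_point :: "(real \<Rightarrow> real) \<Rightarrow> real \<Rightarrow> bool" where
  "parabolic_fixed_point S p \<longleftrightarrow>
     p \<in> {0..1} \<and> S p = p \<and>
     (\<exists>D. (S has_real_derivative D) (at p within {0..1}) \<and> \<bar>D\<bar> = 1)"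

definition forward_orbit :: "('a \<Rightarrow> 'a) \<Rightarrow> 'a \<Rightarrow> 'a set" where
  "forward_orbit S x = {(S ^^ n) x | n. True}"

end

theory Submission imports Defs begin

text \<open>Passing to \<open>S \<circ> S\<close> if necessary, assume \<open>S' p = 1\<close>. Let \<open>x\<^sub>n\<close> be an orbit that avoids \<open>p\<close>, and put
  \<open>d = \<bar>x\<^sub>n - p\<bar>\<close> and \<open>g = \<bar>x\<^sub>n\<^sub>+\<^sub>1 - x\<^sub>n\<bar>\<close>. The orbit tends to \<open>p\<close>, and its gaps decrease, so the points from \<open>x\<^sub>n\<close> on
  are \<open>g\<close>-dense between \<open>p\<close> and \<open>x\<^sub>n\<close>. Hence about \<open>d / g\<close> sets of diameter \<open>g\<close> are needed to cover the
  part of \<open>F\<close> within distance \<open>2 * d\<close> of \<open>x\<^sub>n\<close>, while \<open>d / g \<rightarrow> \<infinity>\<close> because \<open>S' p = 1\<close>.\<close>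

section \<open>Covering numbers and the upper bound on the line\<close>

lemma covering_number_leI:
  assumes "finite \<U>" "\<And>U. U \<in> \<U> \<Longrightarrow> open U \<and> bounded U \<and> diameter U \<le> r" "E \<subseteq> \<Union>\<U>"
  shows "covering_number r E \<le> enat (card \<U>)"
  unfolding covering_number_def using assms by (intro INF_lower) auto

lemma covering_number_leE:
  assumes "ereal_of_enat (covering_number r E) \<le> ereal M"
  obtains \<U> where "finite \<U>" "\<And>U. U \<in> \<U> \<Longrightarrow> open U \<and> bounded U \<and> diameter U \<le> r"
    "E \<subseteq> \<Union>\<U>" "real (card \<U>) \<le> M"
proof -
  obtain k where k: "covering_number r E = enat k"
    using assms by (cases "covering_number r E") auto
  \<comment> \<open>A strict bound on the infimum yields an actual cover; as cardinalities are
    integers, fewer than \<open>Suc k\<close> sets means at most \<open>k\<close>.\<close>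
  have "covering_number r E < enat (Suc k)" by (simp add: k)
  then obtain \<U> where U: "finite \<U>" "\<forall>U\<in>\<U>. open U \<and> bounded U \<and> diameter U \<le> r" "E \<subseteq> \<Union>\<U>"
    "card \<U> < Suc k"
    unfolding covering_number_def INF_less_iff by auto
  have "real (card \<U>) \<le> M" using U(4) assms by (simp add: k)
  with U show ?thesis by (intro that) auto
qed

text \<open>A regular grid of balls of radius \<open>r / 2\<close> is an explicit cover whose size
  is linear in \<open>R / r\<close>, so the exponent 1 is admissible with constant 7.\<close>

lemma covering_number_cball_real_le:
  fixes x :: real
  assumes "0 < r" "r < R"
  shows "ereal_of_enat (covering_number r (cball x R \<inter> F)) \<le> ereal (7 * (R / r))"
proof -
  define K where "K = \<lceil>2 * R / r\<rceil>"
  \<comment> \<open>With spacing \<open>r / 2\<close>, every point is less than \<open>r / 2\<close>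
    to the right of some grid point, or equal to it, so open balls suffice.\<close>
  define c where "c k = x + of_int k * r / 2" for k :: int
  define \<U> where "\<U> = (\<lambda>k. ball (c k) (r / 2)) ` {-K..K}"
  have "cball x R \<inter> F \<subseteq> \<Union>\<U>"
  proof
    fix y assume "y \<in> cball x R \<inter> F"
    then have y: "\<bar>y - x\<bar> \<le> R" by (auto simp: dist_real_def abs_minus_commute)
    define k where "k = \<lfloor>(y - x) * 2 / r\<rfloor>"
    have "of_int k \<le> (y - x) * 2 / r" "(y - x) * 2 / r < of_int k + 1"
      by (simp_all add: k_def)
    then have "of_int k * r \<le> (y - x) * 2" "(y - x) * 2 < of_int k * r + r"
      using \<open>0 < r\<close> by (simp_all add: field_simps)
    then have "y \<in> ball (c k) (r / 2)"
      by (auto simp: c_def dist_real_def abs_if)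
    moreover have "k \<in> {-K..K}"
    proof -
      have a: "- (2 * R / r) \<le> (y - x) * 2 / r" "(y - x) * 2 / r \<le> 2 * R / r"
        using y \<open>0 < r\<close> divide_right_mono[of "- (2 * R)" "(y - x) * 2" r]
          divide_right_mono[of "(y - x) * 2" "2 * R" r] by (simp_all add: abs_le_iff)
      have "\<lfloor>- (2 * R / r)\<rfloor> \<le> k" unfolding k_def by (rule floor_mono[OF a(1)])
      moreover have "k \<le> \<lfloor>2 * R / r\<rfloor>" unfolding k_def by (rule floor_mono[OF a(2)])
      moreover have "\<lfloor>2 * R / r\<rfloor> \<le> K" unfolding K_def by linarith
      moreover have "\<lfloor>- (2 * R / r)\<rfloor> = - K" unfolding K_def by (simp add: floor_minus)
      ultimately show ?thesis by auto
    qed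
    ultimately show "y \<in> \<Union>\<U>" by (auto simp: \<U>_def)
  qed
  then have "covering_number r (cball x R \<inter> F) \<le> enat (card \<U>)"
    using \<open>0 < r\<close> by (intro covering_number_leI) (auto simp: \<U>_def diameter_ball)
  also have "card \<U> \<le> card {-K..K}" unfolding \<U>_def by (rule card_image_le) simp
  finally have *: "covering_number r (cball x R \<inter> F) \<le> enat (card {-K..K})" by simp
  have t: "1 < R / r" using assms by simp
  have "0 \<le> K" unfolding K_def using t by simp
  then have "real (card {-K..K}) = 2 * of_int K + 1" by simp
  also have "\<dots> \<le> 2 * (2 * R / r + 1) + 1"
    unfolding K_def by (intro add_right_mono mult_left_mono of_int_ceiling_le_add_one) simp
  \<comment> \<open>The count is at most \<open>4 * R / r + 3\<close>, and \<open>1 < R / r\<close>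
    absorbs the 3.\<close>
  also have "\<dots> \<le> 7 * (R / r)" using t by simp
  finally have "real (card {-K..K}) \<le> 7 * (R / r)" .
  moreover have "ereal_of_enat (covering_number r (cball x R \<inter> F)) \<le> ereal_of_enat (enat (card {-K..K}))"
    using * by (simp only: ereal_of_enat_le_iff)
  ultimately show ?thesis
    by (metis ereal_less_eq(3) ereal_of_enat_simps(1) order_trans)
qed

lemma assouad_dim_real_le_1: "assouad_dim (F :: real set) \<le> 1"
proof -
  have "assouad_dim F \<le> ereal 1"
    unfolding assouad_dim_def using covering_number_cball_real_le
    by (intro INF_lower) (auto intro!: exI[of _ "7::real"] simp: powr_one)
  then show ?thesis by (simp add: one_ereal_def)
qed

section \<open>Lower bounds from sequences with small gaps\<close>

lemma open_segment_length_le_cover: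
  fixes a b :: real
  assumes "finite I" "open_segment a b \<subseteq> (\<Union>i\<in>I. cball (c i) \<rho>)" "0 \<le> \<rho>"
  shows "\<bar>b - a\<bar> \<le> real (card I) * (2 * \<rho>)"
proof -
  have "\<bar>b - a\<bar> = measure lborel (open_segment a b)"
    by (cases "a \<le> b") (auto simp: open_segment_eq_real_ivl)
  \<comment> \<open>Lengths are compared by Lebesgue measure; a finite union of closed balls is
    compact and so has finite measure, as monotonicity requires.\<close>
  also have "\<dots> \<le> measure lborel (\<Union>i\<in>I. cball (c i) \<rho>)"
    using assms by (intro measure_mono_fmeasurable fmeasurable_compact compact_UN)
      (auto simp: open_segment_eq_real_ivl)
  also have "\<dots> \<le> (\<Sum>i\<in>I. measure lborel (cball (c i) \<rho>))"
    using assms(1) by (intro measure_UNION_le) auto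
  also have "\<dots> = real (card I) * (2 * \<rho>)"
    using \<open>0 \<le> \<rho>\<close> by (simp add: cball_eq_atLeastAtMost)
  finally show ?thesis .
qed

text \<open>A discrete intermediate value argument: the first term below \<open>y\<close> has a
  predecessor at or above \<open>y\<close>, and that jump is at most \<open>g\<close>.\<close>

lemma sequence_crosses_level:
  fixes x :: "nat \<Rightarrow> real"
  assumes "y \<le> x 0" "x m < y" "\<And>i. \<bar>x (Suc i) - x i\<bar> \<le> g"
  shows "\<exists>i. \<bar>x i - y\<bar> \<le> g"
proof -
  define k where "k = (LEAST i. x i < y)"
  have k: "x k < y" unfolding k_def using assms(2) by (rule LeastI)
  then obtain j where j: "k = Suc j" using assms(1) by (cases k) auto
  have "\<not> x j < y" using not_less_Least[of j "\<lambda>i. x i < y"] j by (simp add: k_def)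
  then have "\<bar>x k - y\<bar> \<le> g" using k assms(3)[of j] by (simp add: j abs_if split: if_splits)
  then show ?thesis by blast
qed

lemma sequence_dense_towards_limit:
  fixes x :: "nat \<Rightarrow> real"
  assumes lim: "x \<longlonglongrightarrow> p" and step: "\<And>i. \<bar>x (Suc i) - x i\<bar> \<le> g"
    and y: "y \<in> open_segment p (x 0)"
  shows "\<exists>i. \<bar>x i - y\<bar> \<le> g"
proof (cases "p \<le> x 0")
  case True
  then have "p < y" "y < x 0" using y by (auto simp: open_segment_eq_real_ivl)
  then obtain m where "x m < y"
    using order_tendstoD(2)[OF lim] by (metis eventually_sequentially order_refl)
  with \<open>y < x 0\<close> step show ?thesis by (intro sequence_crosses_level) auto
next
  case False
  then have "y < p" "x 0 < y" using y by (auto simp: open_segment_eq_real_ivl)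
  then obtain m where "y < x m"
    using order_tendstoD(1)[OF lim] by (metis eventually_sequentially order_refl)
  \<comment> \<open>Reflection at the origin turns the increasing crossing into a decreasing
    one.\<close>
  with \<open>x 0 < y\<close> have "\<exists>i. \<bar>- x i - (- y)\<bar> \<le> g"
    using step by (intro sequence_crosses_level[of "-y" "\<lambda>i. - x i" m])
      (auto simp: abs_minus_commute)
  then show ?thesis by (simp add: abs_minus_commute)
qed

text \<open>The sequence is \<open>g\<close>-dense between \<open>p\<close> and \<open>x 0\<close>,
  so doubling the scale turns a cover of its terms into a cover of the whole segment, whose length
  then bounds the number of sets from below.\<close>

lemma covering_number_sequence_ge:
  fixes x :: "nat \<Rightarrow> real"
  assumes lim: "x \<longlonglongrightarrow> p" and step: "\<And>i. \<bar>x (Suc i) - x i\<bar> \<le> g" and "range x \<subseteq> E"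
    and cov: "ereal_of_enat (covering_number g E) \<le> ereal M" and "0 < g"
  shows "\<bar>x 0 - p\<bar> \<le> M * (4 * g)"
proof -
  obtain \<U> where U: "finite \<U>" "\<And>U. U \<in> \<U> \<Longrightarrow> open U \<and> bounded U \<and> diameter U \<le> g"
    "E \<subseteq> \<Union>\<U>" "real (card \<U>) \<le> M"
    using cov by (rule covering_number_leE) blast
  \<comment> \<open>The centre is arbitrary if \<open>U\<close> is empty, but only sets containing
    some \<open>x i\<close> are used below. The radius \<open>2 * g\<close> adds the diameter of
    \<open>U\<close> to the distance from \<open>x i\<close> to \<open>y\<close>.\<close>
  define c where "c U = (SOME u. u \<in> U)" for U :: "real set"
  have "open_segment p (x 0) \<subseteq> (\<Union>U\<in>\<U>. cball (c U) (2 * g))"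
  proof
    fix y assume "y \<in> open_segment p (x 0)"
    then obtain i where i: "\<bar>x i - y\<bar> \<le> g" using sequence_dense_towards_limit[OF lim step] by blast
    obtain V where V: "V \<in> \<U>" "x i \<in> V" using U(3) assms(3) by blast
    then have "c V \<in> V" unfolding c_def by (metis someI)
    then have "dist (c V) (x i) \<le> g"
      using diameter_bounded_bound[of V "c V" "x i"] U(2)[OF V(1)] V(2) by auto
    then have "y \<in> cball (c V) (2 * g)"
      using i by (simp add: dist_real_def abs_le_iff)
    then show "y \<in> (\<Union>U\<in>\<U>. cball (c U) (2 * g))" using V(1) by blast
  qed
  then have "\<bar>x 0 - p\<bar> \<le> real (card \<U>) * (2 * (2 * g))"
    using U(1) \<open>0 < g\<close> by (intro open_segment_length_le_cover) auto
  also have "\<dots> \<le> M * (4 * g)" using U(4) \<open>0 < g\<close> by simp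
  finally show ?thesis .
qed

text \<open>An admissible exponent \<alpha> below 1 would give
  \<open>t \<le> 8 * C * t powr \<alpha>\<close> for the ratio \<open>t = R / g\<close> at each late
  index, which bounds \<open>t powr (1 - \<alpha>)\<close> although \<open>t\<close> is
  unbounded.\<close>

lemma assouad_dim_ge_1_of_sequence:
  fixes x :: "nat \<Rightarrow> real"
  assumes lim: "x \<longlonglongrightarrow> p" and "range x \<subseteq> F" and ne: "\<And>n. x n \<noteq> x (Suc n)"
    and gaps: "decseq (\<lambda>n. \<bar>x (Suc n) - x n\<bar>)"
    and dist: "decseq (\<lambda>n. \<bar>x n - p\<bar>)"
    and ratio: "filterlim (\<lambda>n. \<bar>x n - p\<bar> / \<bar>x (Suc n) - x n\<bar>) at_top sequentially"
  shows "1 \<le> assouad_dim F"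
proof -
  have "1 \<le> \<alpha>" if "0 \<le> \<alpha>" "0 < C" and cov: "\<And>r R z. z \<in> F \<Longrightarrow> 0 < r \<and> r < R \<Longrightarrow>
      ereal_of_enat (covering_number r (cball z R \<inter> F)) \<le> ereal (C * (R / r) powr \<alpha>)"
    for \<alpha> C
  proof (rule ccontr)
    assume "\<not> 1 \<le> \<alpha>"
    define t where "t n = 2 * (\<bar>x n - p\<bar> / \<bar>x (Suc n) - x n\<bar>)" for n
    have t: "filterlim t at_top sequentially"
      unfolding t_def by (rule filterlim_tendsto_pos_mult_at_top[OF tendsto_const _ ratio]) simp
    \<comment> \<open>Exceeding 1 ensures \<open>g < R\<close>; the other threshold is the solution
      of \<open>t powr (1 - \<alpha>) = 8 * C\<close>.\<close>
    then have "\<forall>\<^sub>F n in sequentially. max 1 ((8 * C) powr (1 / (1 - \<alpha>))) < t n"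
      unfolding filterlim_at_top_dense by blast
    then obtain n where "max 1 ((8 * C) powr (1 / (1 - \<alpha>))) < t n"
      using eventually_happens' sequentially_bot by blast
    then have t1: "1 < t n" and "(8 * C) powr (1 / (1 - \<alpha>)) < t n" by auto
    then have "((8 * C) powr (1 / (1 - \<alpha>))) powr (1 - \<alpha>) < t n powr (1 - \<alpha>)"
      using \<open>\<not> 1 \<le> \<alpha>\<close> by (intro powr_less_mono2) auto
    then have big: "8 * C < t n powr (1 - \<alpha>)"
      using \<open>\<not> 1 \<le> \<alpha>\<close> \<open>0 < C\<close> by (simp add: powr_powr)
    define g where "g = \<bar>x (Suc n) - x n\<bar>"
    \<comment> \<open>Later terms are no farther from \<open>p\<close> than \<open>x n\<close>, so
      they stay within twice that distance of \<open>x n\<close>.\<close>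
    define R where "R = 2 * \<bar>x n - p\<bar>"
    have g: "0 < g" using ne[of n] by (simp add: g_def)
    have tn: "t n = R / g" by (simp add: t_def R_def g_def)
    have "g < R" using t1 g by (simp add: tn field_simps)
    have "\<bar>x (0 + n) - p\<bar> \<le> (C * (R / g) powr \<alpha>) * (4 * g)"
    proof (rule covering_number_sequence_ge)
      show "(\<lambda>i. x (i + n)) \<longlonglongrightarrow> p" using lim by (rule LIMSEQ_ignore_initial_segment)
      show "\<bar>x (Suc i + n) - x (i + n)\<bar> \<le> g" for i
        using decseqD[OF gaps, of n "i + n"] by (simp add: g_def)
      show "range (\<lambda>i. x (i + n)) \<subseteq> cball (x n) R \<inter> F"
      proof -
        have "dist (x n) (x (i + n)) \<le> R" for i
          using decseqD[OF dist, of n "i + n"] abs_triangle_ineq4[of "x n - p" "x (i + n) - p"]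
          by (simp add: R_def dist_real_def)
        then show ?thesis using assms(2) by auto
      qed
      show "ereal_of_enat (covering_number g (cball (x n) R \<inter> F)) \<le> ereal (C * (R / g) powr \<alpha>)"
        using cov g \<open>g < R\<close> assms(2) by blast
    qed (fact g)
    \<comment> \<open>The 8 combines the 4 of the covering bound with the 2 in
      \<open>R\<close>.\<close>
    then have "R \<le> 8 * C * (R / g) powr \<alpha> * g" by (simp add: R_def mult_ac)
    then have "t n \<le> 8 * C * t n powr \<alpha>" using g by (simp add: tn divide_le_eq)
    also have "\<dots> < t n powr (1 - \<alpha>) * t n powr \<alpha>" using big t1 by simp
    also have "\<dots> = t n" using t1 by (simp flip: powr_add)
    finally show False by simp
  qed
  then have "ereal 1 \<le> assouad_dim F"
    unfolding assouad_dim_def by (intro INF_greatest) auto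
  then show ?thesis by (simp add: one_ereal_def)
qed

section \<open>Contractive interval maps and their orbits\<close>

lemma contractive_interval_map_in:
  assumes "contractive_interval_map S" "x \<in> {0..1}"
  shows "S x \<in> {0..1}"
  using assms unfolding contractive_interval_map_def by blast

lemma contractive_interval_map_less:
  assumes "contractive_interval_map S" "x \<in> {0..1}" "y \<in> {0..1}" "x \<noteq> y"
  shows "\<bar>S x - S y\<bar> < \<bar>x - y\<bar>"
  using assms unfolding contractive_interval_map_def by blast

lemma contractive_interval_map_le:
  assumes "contractive_interval_map S" "x \<in> {0..1}" "y \<in> {0..1}"
  shows "\<bar>S x - S y\<bar> \<le> \<bar>x - y\<bar>"
  using contractive_interval_map_less[OF assms] by (cases "x = y") auto

lemma contractive_interval_map_comp:
  assumes "contractive_interval_map S"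
  shows "contractive_interval_map (S \<circ> S)"
  unfolding contractive_interval_map_def
proof (intro conjI ballI impI)
  show "(S \<circ> S) ` {0..1} \<subseteq> {0..1}"
    using contractive_interval_map_in[OF assms] by (metis comp_apply image_subsetI)
next
  fix x y :: real assume "x \<in> {0..1}" "y \<in> {0..1}" "x \<noteq> y"
  then show "\<bar>(S \<circ> S) x - (S \<circ> S) y\<bar> < \<bar>x - y\<bar>"
    using contractive_interval_map_le[OF assms, of "S x" "S y"]
      contractive_interval_map_less[OF assms, of x y] contractive_interval_map_in[OF assms]
    by (metis comp_apply order_le_less_trans)
qed

lemma contractive_interval_map_continuous_on:
  assumes "contractive_interval_map S"
  shows "continuous_on {0..1} S"
proof (rule continuous_onI)
  fix x e :: real assume "x \<in> {0..1}" "e > 0"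
  then show "\<exists>d>0. \<forall>x'\<in>{0..1}. dist x' x < d \<longrightarrow> dist (S x') (S x) \<le> e"
    using contractive_interval_map_le[OF assms]
    by (intro exI[of _ e]) (force simp: dist_real_def)
qed

text \<open>The distances to \<open>p\<close> decrease to some \<open>L\<close>. A subsequential
  limit \<open>l\<close> and its image \<open>S l\<close> both lie at distance \<open>L\<close> from
  \<open>p\<close>, which strict contraction allows only for \<open>l = p\<close>.\<close>

lemma contractive_interval_map_orbit_tendsto:
  assumes S: "contractive_interval_map S" and p: "p \<in> {0..1}" "S p = p"
    and x: "x \<in> {0..1}"
  shows "(\<lambda>n. (S ^^ n) x) \<longlonglongrightarrow> p"
proof -
  define u where "u n = (S ^^ n) x" for n
  have u01: "u n \<in> {0..1}" for n
    by (induction n) (use x contractive_interval_map_in[OF S] in \<open>auto simp: u_def\<close>)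
  have uSuc: "u (Suc n) = S (u n)" for n by (simp add: u_def)
  have "decseq (\<lambda>n. \<bar>u n - p\<bar>)"
    using contractive_interval_map_le[OF S u01 p(1)] by (simp add: decseq_Suc_iff uSuc p(2))
  then obtain L where L: "(\<lambda>n. \<bar>u n - p\<bar>) \<longlonglongrightarrow> L" using decseq_convergent[of _ 0] by (metis abs_ge_zero)
  obtain l and r :: "nat \<Rightarrow> nat" where l: "l \<in> {0..1}" "strict_mono r" "(u \<circ> r) \<longlonglongrightarrow> l"
    using compact_Icc[of 0 "1::real"] u01 unfolding compact_def by blast
  have "(\<lambda>n. \<bar>(u \<circ> r) n - p\<bar>) \<longlonglongrightarrow> \<bar>l - p\<bar>" using l(3) by (intro tendsto_intros)
  moreover have "(\<lambda>n. \<bar>(u \<circ> r) n - p\<bar>) \<longlonglongrightarrow> L"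
    using LIMSEQ_subseq_LIMSEQ[OF L l(2)] by (simp add: comp_def)
  ultimately have L1: "L = \<bar>l - p\<bar>" using LIMSEQ_unique by blast
  have "(\<lambda>n. S ((u \<circ> r) n)) \<longlonglongrightarrow> S l"
    using continuous_on_tendsto_compose[OF contractive_interval_map_continuous_on[OF S] l(3,1)] u01
    by simp
  then have "(\<lambda>n. \<bar>S ((u \<circ> r) n) - p\<bar>) \<longlonglongrightarrow> \<bar>S l - p\<bar>" by (intro tendsto_intros)
  \<comment> \<open>Applying \<open>S\<close> shifts the index by one, which leaves the limit of the
    distances unchanged.\<close>
  moreover have "(\<lambda>n. \<bar>S ((u \<circ> r) n) - p\<bar>) \<longlonglongrightarrow> L"
    using LIMSEQ_subseq_LIMSEQ[OF LIMSEQ_Suc[OF L] l(2)] by (simp add: comp_def uSuc)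
  ultimately have "\<bar>S l - p\<bar> = \<bar>l - p\<bar>" using L1 LIMSEQ_unique by blast
  then have "l = p" using contractive_interval_map_less[OF S l(1) p(1)] p(2) by fastforce
  then have "(\<lambda>n. \<bar>u n - p\<bar>) \<longlonglongrightarrow> 0" using L L1 by simp
  then show ?thesis by (simp add: u_def tendsto_rabs_zero_iff LIM_zero_iff)
qed

text \<open>Along the orbit, gap over distance to \<open>p\<close> is the deviation of the
  difference quotient at \<open>p\<close> from 1. It tends to 0, so its inverse tends to
  infinity.\<close>

lemma assouad_dim_ge_1_of_derivative_1:
  assumes S: "contractive_interval_map S" and p: "p \<in> {0..1}" "S p = p"
    and der: "(S has_real_derivative 1) (at p within {0..1})"
    and "F \<subseteq> {0..1}" "S ` F \<subseteq> F" and x: "x \<in> F" and avoid: "\<And>n. (S ^^ n) x \<noteq> p"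
  shows "1 \<le> assouad_dim F"
proof -
  define u where "u n = (S ^^ n) x" for n
  have uF: "u n \<in> F" for n by (induction n) (use assms in \<open>auto simp: u_def\<close>)
  then have u01: "u n \<in> {0..1}" for n using assms by blast
  have uSuc: "u (Suc n) = S (u n)" for n by (simp add: u_def)
  have up: "u n \<noteq> p" for n using avoid by (simp add: u_def)
  have lim: "u \<longlonglongrightarrow> p"
    using contractive_interval_map_orbit_tendsto[OF S p, of x] u01[of 0] unfolding u_def by simp
  \<comment> \<open>A repeated term would be a second fixed point, contradicting strict
    contraction.\<close>
  have ne: "u n \<noteq> u (Suc n)" for n
    using contractive_interval_map_less[OF S u01 p(1) up, of n] p(2) by (auto simp: uSuc)
  have "((\<lambda>y. (S y - p) / (y - p)) \<longlongrightarrow> 1) (at p within {0..1})"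
    using der p(2) by (simp add: has_field_derivative_iff)
  \<comment> \<open>The punctured filter makes it essential that the orbit never hits
    \<open>p\<close>.\<close>
  moreover have "filterlim u (at p within {0..1}) sequentially"
    using lim u01 up by (auto simp: filterlim_at)
  ultimately have "(\<lambda>n. (S (u n) - p) / (u n - p)) \<longlonglongrightarrow> 1"
    by (rule filterlim_compose)
  then have "(\<lambda>n. \<bar>(S (u n) - p) / (u n - p) - 1\<bar>) \<longlonglongrightarrow> \<bar>1 - 1\<bar>"
    by (intro tendsto_intros)
  moreover have "\<bar>(S (u n) - p) / (u n - p) - 1\<bar> = \<bar>u (Suc n) - u n\<bar> / \<bar>u n - p\<bar>" for n
    using up[of n] by (simp add: uSuc divide_simps flip: abs_divide)
  ultimately have q: "(\<lambda>n. \<bar>u (Suc n) - u n\<bar> / \<bar>u n - p\<bar>) \<longlonglongrightarrow> 0" by simp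
  have "filterlim (\<lambda>n. inverse (\<bar>u (Suc n) - u n\<bar> / \<bar>u n - p\<bar>)) at_top sequentially"
    using ne up by (intro filterlim_inverse_at_top q always_eventually)
      (metis abs_divide zero_less_abs_iff divide_eq_0_iff eq_iff_diff_eq_0)
  then have "filterlim (\<lambda>n. \<bar>u n - p\<bar> / \<bar>u (Suc n) - u n\<bar>) at_top sequentially" by simp
  moreover have "decseq (\<lambda>n. \<bar>u (Suc n) - u n\<bar>)"
    using contractive_interval_map_le[OF S u01 u01]
    by (subst decseq_Suc_iff) (metis uSuc)
  moreover have "decseq (\<lambda>n. \<bar>u n - p\<bar>)"
    using contractive_interval_map_le[OF S u01 p(1)] by (simp add: decseq_Suc_iff uSuc p(2))
  ultimately show ?thesis
    using assouad_dim_ge_1_of_sequence[OF lim, of F] uF ne by blast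
qed

theorem theorem9p2p1:
  fixes S :: "real \<Rightarrow> real" and p :: real and F :: "real set"
  assumes "contractive_interval_map S"
    and "parabolic_fixed_point S p"
    and "F \<subseteq> {0..1}"
    and "\<exists>x\<in>F. p \<notin> forward_orbit S x"
    and "S ` F \<subseteq> F"
  shows "assouad_dim F = 1"
proof (rule antisym)
  show "assouad_dim F \<le> 1" by (rule assouad_dim_real_le_1)
  obtain D where p: "p \<in> {0..1}" "S p = p" and D: "(S has_real_derivative D) (at p within {0..1})"
    and D1: "\<bar>D\<bar> = 1"
    using assms(2) unfolding parabolic_fixed_point_def by blast
  obtain x where x: "x \<in> F" and "p \<notin> forward_orbit S x" using assms(4) by blast
  then have avoid: "(S ^^ n) x \<noteq> p" for n unfolding forward_orbit_def by auto
  \<comment> \<open>Squaring treats \<open>D = 1\<close> and \<open>D = -1\<close> alike.\<close>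
  have "((S \<circ> S) has_real_derivative D * D) (at p within {0..1})"
  proof (rule DERIV_image_chain)
    have "S ` {0..1} \<subseteq> {0..1}" using assms(1) by (simp add: contractive_interval_map_def)
    then show "(S has_real_derivative D) (at (S p) within S ` {0..1})"
      using D p(2) DERIV_subset by metis
  qed (fact D)
  moreover have "D * D = 1" using D1 by (auto simp: abs_if split: if_splits)
  ultimately have "((S \<circ> S) has_real_derivative 1) (at p within {0..1})" by simp
  moreover have "((S \<circ> S) ^^ n) x \<noteq> p" for n
  proof -
    \<comment> \<open>Orbits of \<open>S \<circ> S\<close> consist of even iterates of
      \<open>S\<close>, so they avoid \<open>p\<close> as well.\<close>
    have "(S \<circ> S) ^^ n = S ^^ (2 * n)" by (induction n) (auto simp: fun_eq_iff)
    then show ?thesis using avoid by metis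
  qed
  moreover have "(S \<circ> S) ` F \<subseteq> F" using assms(5) by auto
  ultimately show "1 \<le> assouad_dim F"
    using assms(3) x p contractive_interval_map_comp[OF assms(1)]
    by (intro assouad_dim_ge_1_of_derivative_1[of "S \<circ> S" p F x]) auto
qed

end
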